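(* For any odd prime $p$, there exists a finite group $G$ (of order divisible by $p$) admitting an irreducible $p$-constant character $\chi$ with $c_\chi=+2$.
   Context: For a finite group $G$ and a prime $p$ dividing $|G|$, an element of $G$ is $p$-singular if its order is divisible by $p$. A complex irreducible character $\chi$ of $G$ is $p$-constant if there is a constant $c_\chi$ with $\chi(g)=c_\chi$ for all $p$-singular elements $g\in G$. *)

theory Defs
  imports
    "HOL-Algebra.Multiplicative_Group"
    "HOL-Computational_Algebra.Primes"
    "Jordan_Normal_Form.VS_Connect"
begin

definition GL_mat :: "nat \<Rightarrow> complex mat monoid" where
  "GL_mat n = units_of (ring_mat TYPE(complex) n ())"

definition complex_representation ::
    "('a, 'b) monoid_scheme \<Rightarrow> nat \<Rightarrow> ('a \<Rightarrow> complex mat) \<Rightarrow> bool" where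
  "complex_representation G n \<rho> \<longleftrightarrow> \<rho> \<in> hom G (GL_mat n)"

definition irreducible_representation ::
    "('a, 'b) monoid_scheme \<Rightarrow> nat \<Rightarrow> ('a \<Rightarrow> complex mat) \<Rightarrow> bool" where
  "irreducible_representation G n \<rho> \<longleftrightarrow>
     complex_representation G n \<rho> \<and> n > 0 \<and>
     (\<forall>W. VectorSpace.subspace class_ring W (module_vec TYPE(complex) n) \<longrightarrow>
          (\<forall>g\<in>carrier G. \<forall>w\<in>W. \<rho> g *\<^sub>v w \<in> W) \<longrightarrow>
          W = {0\<^sub>v n} \<or> W = carrier_vec n)"

definition mat_trace :: "'a::comm_monoid_add mat \<Rightarrow> 'a" where
  "mat_trace A = (\<Sum>i<dim_row A. A $$ (i, i))"

text \<open>The values of a character outside the carrier are irrelevant.\<close>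

definition irreducible_character ::
    "('a, 'b) monoid_scheme \<Rightarrow> ('a \<Rightarrow> complex) \<Rightarrow> bool" where
  "irreducible_character G \<chi> \<longleftrightarrow>
     (\<exists>n \<rho>. irreducible_representation G n \<rho> \<and> (\<forall>g\<in>carrier G. \<chi> g = mat_trace (\<rho> g)))"

definition p_singular :: "('a, 'b) monoid_scheme \<Rightarrow> nat \<Rightarrow> 'a \<Rightarrow> bool" where
  "p_singular G p g \<longleftrightarrow> g \<in> carrier G \<and> p dvd group.ord G g"

text \<open>\<open>p_constant_with G p \<chi> c\<close> says that \<open>\<chi>\<close> is \<open>p\<close>-constant with constant \<open>c\<close>.
  The constant is unique when \<open>p\<close> is a prime dividing the order of the finite group \<open>G\<close>,
  because \<open>G\<close> then has \<open>p\<close>-singular elements; otherwise the condition may be vacuous.\<close>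

definition p_constant_with ::
    "('a, 'b) monoid_scheme \<Rightarrow> nat \<Rightarrow> ('a \<Rightarrow> complex) \<Rightarrow> complex \<Rightarrow> bool" where
  "p_constant_with G p \<chi> c \<longleftrightarrow> (\<forall>g. p_singular G p g \<longrightarrow> \<chi> g = c)"

end

theory Submission
  imports Defs "HOL-Algebra.Weak_Morphisms"
begin

text \<open>
  A character is constant on the \<open>p\<close>-singular elements with value its degree as soon as all
  of them lie in its kernel. To get the constant \<open>2\<close> it therefore suffices to find a
  finite group \<open>V \<rtimes> H\<close> in which \<open>V\<close> is a nontrivial \<open>p\<close>-group, \<open>H\<close> has an irreducible
  character of degree \<open>2\<close>, and no element outside \<open>V\<close> has order divisible by \<open>p\<close>; the
  character of \<open>H\<close> is then inflated to \<open>V \<rtimes> H\<close>.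

  Such a group exists uniformly in the odd prime \<open>p\<close>: take for \<open>H\<close> the quaternion group
  \<open>Q\<^sub>8\<close>, realised as the eight units of the ring of integral Hamilton quaternions,
  and for \<open>V\<close> the additive group of this ring modulo \<open>p\<close>, on which \<open>H\<close> acts by left
  multiplication. The elements of \<open>V \<rtimes> H\<close> are the affine maps \<open>x \<mapsto> v + h x\<close>. A unit
  \<open>h \<noteq> 1\<close> satisfies \<open>h = -1\<close> or \<open>h\<^sup>2 = -1\<close>, hence \<open>1 + h + h\<^sup>2 + h\<^sup>3 = (1 + h) (1 + h\<^sup>2) = 0\<close>
  and \<open>h^4 = 1\<close>. Therefore the fourth power of every affine map with linear
  part \<open>h\<close> is the identity, and its order divides \<open>4\<close> and is prime to \<open>p\<close>
  (\<open>p_singular_affine_group\<close>).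

  The embedding of the quaternions into the complex \<open>2 \<times> 2\<close> matrices restricts to a
  representation of \<open>Q\<^sub>8\<close>. It is irreducible because a subspace stable under the diagonal
  matrix of \<open>i\<close> contains the coordinate components of its vectors, and the matrix of \<open>j\<close>
  interchanges the two coordinate lines (\<open>Q8_invariant_subspace\<close>).
\<close>

section \<open>Integral quaternions and their units\<close>

datatype quat = Quat (re: int) (im1: int) (im2: int) (im3: int)

lemma quat_eq_iff: "x = y \<longleftrightarrow> re x = re y \<and> im1 x = im1 y \<and> im2 x = im2 y \<and> im3 x = im3 y"
  by (cases x; cases y) simp

instantiation quat :: ring_1
begin

definition "0 = Quat 0 0 0 0"
definition "1 = Quat 1 0 0 0"
definition "x + y = Quat (re x + re y) (im1 x + im1 y) (im2 x + im2 y) (im3 x + im3 y)"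
definition "x - y = Quat (re x - re y) (im1 x - im1 y) (im2 x - im2 y) (im3 x - im3 y)"
definition "- x = Quat (- re x) (- im1 x) (- im2 x) (- im3 x)"
definition "x * y = Quat
  (re x * re y - im1 x * im1 y - im2 x * im2 y - im3 x * im3 y)
  (re x * im1 y + im1 x * re y + im2 x * im3 y - im3 x * im2 y)
  (re x * im2 y - im1 x * im3 y + im2 x * re y + im3 x * im1 y)
  (re x * im3 y + im1 x * im2 y - im2 x * im1 y + im3 x * re y)"

instance
  by standard
    (simp_all add: quat_eq_iff zero_quat_def one_quat_def plus_quat_def minus_quat_def
      uminus_quat_def times_quat_def algebra_simps)

end

lemmas quat_defs = zero_quat_def one_quat_def plus_quat_def minus_quat_def uminus_quat_def
  times_quat_def

definition qnorm :: "quat \<Rightarrow> int" where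
  "qnorm x = (re x)\<^sup>2 + (im1 x)\<^sup>2 + (im2 x)\<^sup>2 + (im3 x)\<^sup>2"

definition qcnj :: "quat \<Rightarrow> quat" where
  "qcnj x = Quat (re x) (- im1 x) (- im2 x) (- im3 x)"

text \<open>An integral quaternion is invertible if and only if its norm is \<open>1\<close>, and the equation
  \<open>a\<^sup>2 + b\<^sup>2 + c\<^sup>2 + d\<^sup>2 = 1\<close> leaves only \<open>\<plusminus>1, \<plusminus>i, \<plusminus>j, \<plusminus>k\<close>. Describing this set by the norm
  makes closure under products a consequence of multiplicativity instead of a table.\<close>

definition Q8 :: "quat set" where
  "Q8 = {h. qnorm h = 1}"

lemma qnorm_mult: "qnorm (x * y) = qnorm x * qnorm y"
  by (simp add: qnorm_def times_quat_def power2_eq_square algebra_simps)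

lemma Q8_mult: "h \<in> Q8 \<Longrightarrow> k \<in> Q8 \<Longrightarrow> h * k \<in> Q8"
  by (simp add: Q8_def qnorm_mult)

lemma Q8_one: "1 \<in> Q8"
  by (simp add: Q8_def qnorm_def one_quat_def)

lemma Q8_qcnj: "h \<in> Q8 \<Longrightarrow> qcnj h \<in> Q8"
  by (simp add: Q8_def qnorm_def qcnj_def)

lemma Q8_qcnj_mult:
  assumes "h \<in> Q8"
  shows "qcnj h * h = 1" "h * qcnj h = 1"
  using assms by (simp_all add: Q8_def qnorm_def qcnj_def quat_defs power2_eq_square algebra_simps)

lemma finite_Q8: "finite Q8"
proof -
  have bound: "a \<in> {-1..1}" if "a\<^sup>2 \<le> 1" for a :: int
    using abs_square_le_1[of a] that by auto
  have "Q8 \<subseteq> (\<lambda>(a, b, c, d). Quat a b c d) ` ({-1..1} \<times> {-1..1} \<times> {-1..1} \<times> {-1..1})"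
  proof
    fix h assume "h \<in> Q8"
    then have "(re h)\<^sup>2 + (im1 h)\<^sup>2 + (im2 h)\<^sup>2 + (im3 h)\<^sup>2 = 1"
      by (simp add: Q8_def qnorm_def)
    then have "(re h)\<^sup>2 \<le> 1" "(im1 h)\<^sup>2 \<le> 1" "(im2 h)\<^sup>2 \<le> 1" "(im3 h)\<^sup>2 \<le> 1"
      using zero_le_power2[of "re h"] zero_le_power2[of "im1 h"]
        zero_le_power2[of "im2 h"] zero_le_power2[of "im3 h"] by linarith+
    then have "(re h, im1 h, im2 h, im3 h) \<in> {-1..1} \<times> {-1..1} \<times> {-1..1} \<times> {-1..1}"
      by (simp only: mem_Sigma_iff bound)
    then show "h \<in> (\<lambda>(a, b, c, d). Quat a b c d) ` ({-1..1} \<times> {-1..1} \<times> {-1..1} \<times> {-1..1})"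
      by (rule rev_image_eqI) simp
  qed
  then show ?thesis
    by (rule finite_subset) simp
qed

text \<open>Every quaternion is a root of \<open>X\<^sup>2 - 2 a X + n\<close>, where \<open>a\<close> is its real part and \<open>n\<close> its
  norm. If \<open>n = 1\<close> and \<open>a = 0\<close>, its square is \<open>-1\<close>; if \<open>n = 1\<close> and \<open>a \<noteq> 0\<close>, the
  integrality of the coordinates forces it to be \<open>\<plusminus>1\<close>.\<close>

lemma Q8_cases:
  assumes "h \<in> Q8"
  obtains "h = 1" | "h = -1" | "h * h = -1"
proof -
  have norm: "(re h)\<^sup>2 + (im1 h)\<^sup>2 + (im2 h)\<^sup>2 + (im3 h)\<^sup>2 = 1"
    using assms by (simp add: Q8_def qnorm_def)
  show thesis
  proof (cases "re h = 0")
    case True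
    with norm have "h * h = -1"
      by (simp add: quat_defs power2_eq_square)
    then show thesis by (rule that)
  next
    case False
    then have "(re h)\<^sup>2 \<ge> 1"
      by (simp add: int_one_le_iff_zero_less)
    with norm have sq: "(im1 h)\<^sup>2 \<le> 0" "(im2 h)\<^sup>2 \<le> 0" "(im3 h)\<^sup>2 \<le> 0"
      using zero_le_power2[of "im1 h"] zero_le_power2[of "im2 h"] zero_le_power2[of "im3 h"]
      by linarith+
    then have im: "im1 h = 0" "im2 h = 0" "im3 h = 0"
      by simp_all
    with norm have "re h = 1 \<or> re h = -1"
      by (simp add: power2_eq_1_iff)
    with im show thesis
      using that by (auto simp: quat_eq_iff quat_defs)
  qed
qed

text \<open>The sum \<open>(1 + h) (1 + h\<^sup>2)\<close> is the linear factor that a translation acquires in the fourth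
  power of the affine map \<open>x \<mapsto> v + h x\<close>.\<close>

lemma Q8_sum_powers:
  assumes "h \<in> Q8" "h \<noteq> 1"
  shows "1 + h + h * h + h * h * h = 0" "h * h * h * h = 1"
proof -
  consider "h = -1" | "h * h = -1"
    using assms Q8_cases by blast
  then have "1 + h + h * h + h * h * h = 0 \<and> h * h * h * h = 1"
    by cases simp_all
  then show "1 + h + h * h + h * h * h = 0" "h * h * h * h = 1"
    by blast+
qed

section \<open>Affine maps over the quaternions modulo an integer\<close>

text \<open>Residue classes are represented by their reduced representatives, so that the quaternions
  modulo \<open>p\<close> are the range of this map and \<open>p\<close> can be a variable.\<close>

definition qmod :: "nat \<Rightarrow> quat \<Rightarrow> quat" where
  "qmod p x = Quat (re x mod int p) (im1 x mod int p) (im2 x mod int p) (im3 x mod int p)"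

lemma of_nat_quat: "of_nat n = Quat (int n) 0 0 0"
  by (induction n) (simp_all add: quat_defs)

lemma qmod_add_multiple: "qmod p (x + of_nat p * z) = qmod p x"
  by (simp add: qmod_def of_nat_quat plus_quat_def times_quat_def)

lemma qmod_eq_add_multiple: obtains z where "qmod p x = x + of_nat p * z"
proof
  let ?d = "\<lambda>a. - (a div int p)"
  show "qmod p x = x + of_nat p * Quat (?d (re x)) (?d (im1 x)) (?d (im2 x)) (?d (im3 x))"
    by (simp add: qmod_def of_nat_quat plus_quat_def times_quat_def minus_mult_div_eq_mod)
qed

text \<open>Reduction may be dropped inside sums and inside right factors because the multiples of
  \<open>p\<close> form a left ideal: \<open>h (p z) = p (h z)\<close>, the integer \<open>p\<close> being central.\<close>

lemma qmod_simps:
  "qmod p (qmod p x) = qmod p x"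
  "qmod p (qmod p x + y) = qmod p (x + y)"
  "qmod p (x + qmod p y) = qmod p (x + y)"
  "qmod p (x + h * qmod p y) = qmod p (x + h * y)"
proof -
  show add_right: "qmod p (x + qmod p y) = qmod p (x + y)" for x y
    by (simp add: qmod_def plus_quat_def mod_simps)
  show "qmod p (qmod p x + y) = qmod p (x + y)"
    using add_right[of y x] by (simp add: add.commute)
  show "qmod p (qmod p x) = qmod p x"
    by (simp add: qmod_def)
  obtain z where "qmod p y = y + of_nat p * z"
    by (rule qmod_eq_add_multiple)
  then have "x + h * qmod p y = x + h * y + of_nat p * (h * z)"
    by (metis add.assoc distrib_left mult.assoc mult_of_nat_commute)
  then show "qmod p (x + h * qmod p y) = qmod p (x + h * y)"
    by (simp only: qmod_add_multiple)
qed

lemma range_qmod: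
  assumes "p > 0"
  shows "range (qmod p) =
    (\<lambda>(a, b, c, d). Quat a b c d) ` ({0..<int p} \<times> {0..<int p} \<times> {0..<int p} \<times> {0..<int p})"
    (is "_ = ?Q ` ?box")
proof
  show "range (qmod p) \<subseteq> ?Q ` ?box"
  proof
    fix x assume "x \<in> range (qmod p)"
    then have "x = ?Q (re x, im1 x, im2 x, im3 x)" "(re x, im1 x, im2 x, im3 x) \<in> ?box"
      using assms by (auto simp: qmod_def)
    then show "x \<in> ?Q ` ?box"
      by (rule image_eqI)
  qed
  show "?Q ` ?box \<subseteq> range (qmod p)"
  proof
    fix x assume "x \<in> ?Q ` ?box"
    then have "x = qmod p x"
      by (auto simp: qmod_def)
    then show "x \<in> range (qmod p)"
      by blast
  qed
qed

lemma card_range_qmod: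
  assumes "p > 0"
  shows "card (range (qmod p)) = p ^ 4"
  unfolding range_qmod[OF assms]
  by (subst card_image) (auto simp: inj_on_def power4_eq_xxxx)

text \<open>The pair \<open>(v, h)\<close> stands for the affine map \<open>x \<mapsto> v + h x\<close> and the product for composition.\<close>

definition affine_group :: "nat \<Rightarrow> (quat \<times> quat) monoid" where
  "affine_group p = \<lparr>carrier = range (qmod p) \<times> Q8,
     mult = (\<lambda>(v, h) (w, k). (qmod p (v + h * w), h * k)),
     one = (0, 1)\<rparr>"

lemma affine_group_simps:
  "carrier (affine_group p) = range (qmod p) \<times> Q8"
  "(v, h) \<otimes>\<^bsub>affine_group p\<^esub> (w, k) = (qmod p (v + h * w), h * k)"
  "\<one>\<^bsub>affine_group p\<^esub> = (0, 1)"
  by (simp_all add: affine_group_def)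

lemma qmod_0: "qmod p 0 = 0"
  by (simp add: qmod_def zero_quat_def)

lemma group_affine_group: "group (affine_group p)"
proof (rule groupI)
  show "\<one>\<^bsub>affine_group p\<^esub> \<in> carrier (affine_group p)"
    by (metis affine_group_simps(1,3) Q8_one SigmaI qmod_0 rangeI)
next
  fix x assume x: "x \<in> carrier (affine_group p)"
  then obtain v h where [simp]: "x = (qmod p v, h)" and h: "h \<in> Q8"
    by (auto simp: affine_group_simps)
  show "\<one>\<^bsub>affine_group p\<^esub> \<otimes>\<^bsub>affine_group p\<^esub> x = x"
    by (simp add: affine_group_simps qmod_simps)
  have "(qmod p (- (qcnj h * v)), qcnj h) \<otimes>\<^bsub>affine_group p\<^esub> x = \<one>\<^bsub>affine_group p\<^esub>"
    unfolding affine_group_simps \<open>x = _\<close> qmod_simps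
    using h by (simp add: qmod_0 Q8_qcnj_mult)
  moreover have "(qmod p (- (qcnj h * v)), qcnj h) \<in> carrier (affine_group p)"
    using h by (simp add: affine_group_simps Q8_qcnj)
  ultimately show "\<exists>y\<in>carrier (affine_group p). y \<otimes>\<^bsub>affine_group p\<^esub> x = \<one>\<^bsub>affine_group p\<^esub>"
    by blast
next
  fix x y z
  show "x \<otimes>\<^bsub>affine_group p\<^esub> y \<otimes>\<^bsub>affine_group p\<^esub> z =
    x \<otimes>\<^bsub>affine_group p\<^esub> (y \<otimes>\<^bsub>affine_group p\<^esub> z)"
    by (cases x; cases y; cases z) (simp add: affine_group_simps qmod_simps algebra_simps)
qed (auto simp: affine_group_simps Q8_mult)

lemma order_affine_group: "p > 0 \<Longrightarrow> Coset.order (affine_group p) = p ^ 4 * card Q8"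
  by (simp add: Coset.order_def affine_group_simps card_cartesian_product card_range_qmod)

lemma finite_affine_group: "p > 0 \<Longrightarrow> finite (carrier (affine_group p))"
  by (simp add: affine_group_simps finite_Q8 range_qmod)

text \<open>The fourth power of \<open>(v, h)\<close> is \<open>((1 + h + h\<^sup>2 + h\<^sup>3) v, h^4)\<close>, which is the identity for
  \<open>h \<noteq> 1\<close>. The order of such an element divides \<open>4\<close>, so an odd prime cannot divide it.\<close>

lemma p_singular_affine_group:
  assumes "Factorial_Ring.prime p" "odd p" and g: "p_singular (affine_group p) p (v, h)"
  shows "h = 1"
proof (rule ccontr)
  assume "h \<noteq> 1"
  interpret group "affine_group p"
    by (rule group_affine_group)
  have mem: "(v, h) \<in> carrier (affine_group p)" and dvd: "p dvd ord (v, h)"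
    using g by (simp_all add: p_singular_def)
  have h: "h \<in> Q8"
    using mem by (simp add: affine_group_simps)
  have pow: "(v, h) [^]\<^bsub>affine_group p\<^esub> (4::nat) =
    (qmod p ((1 + h + h * h + h * h * h) * v), h * h * h * h)"
    using mem
    by (simp add: numeral_eq_Suc nat_pow_Suc nat_pow_0 affine_group_simps qmod_simps algebra_simps)
  have "(v, h) [^]\<^bsub>affine_group p\<^esub> (4::nat) = \<one>\<^bsub>affine_group p\<^esub>"
    unfolding pow Q8_sum_powers[OF h \<open>h \<noteq> 1\<close>] by (simp add: qmod_0 affine_group_simps)
  then have "ord (v, h) dvd 4"
    using pow_eq_id[OF mem] by blast
  with dvd have "p dvd 2 ^ 2"
    by (auto intro: dvd_trans)
  then have "p dvd 2"
    using assms(1) by (rule prime_dvd_power[rotated])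
  then show False
    using assms(1,2) by (metis dvd_refl primes_dvd_imp_eq two_is_prime_nat)
qed

section \<open>The two-dimensional representation of the quaternion group\<close>

text \<open>The quaternion \<open>a + b i + c j + d k\<close> equals \<open>(a + b i) + (c + d i) j\<close>; its rows are those of
  right multiplication by it on the quaternions as a left complex vector space with
  basis \<open>1, j\<close>.\<close>

definition quat_mat :: "quat \<Rightarrow> complex mat" where
  "quat_mat x = mat 2 2 (\<lambda>(r, s).
     if r = 0 then if s = 0 then Complex (re x) (im1 x) else Complex (im2 x) (im3 x)
     else if s = 0 then Complex (- im2 x) (im3 x) else Complex (re x) (- im1 x))"

lemma quat_mat_carrier: "quat_mat x \<in> carrier_mat 2 2"
  by (simp add: quat_mat_def)

lemma quat_mat_index:
  "quat_mat x $$ (0, 0) = Complex (re x) (im1 x)"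
  "quat_mat x $$ (0, Suc 0) = Complex (im2 x) (im3 x)"
  "quat_mat x $$ (Suc 0, 0) = Complex (- im2 x) (im3 x)"
  "quat_mat x $$ (Suc 0, Suc 0) = Complex (re x) (- im1 x)"
  "dim_row (quat_mat x) = 2" "dim_col (quat_mat x) = 2"
  by (simp_all add: quat_mat_def)

lemma quat_mat_mult: "quat_mat (x * y) = quat_mat x * quat_mat y"
  by (rule eq_matI)
    (auto simp: less_Suc_eq quat_mat_index scalar_prod_def numeral_2_eq_2 times_quat_def
      complex_eq_iff algebra_simps)

lemma quat_mat_one: "quat_mat 1 = 1\<^sub>m 2"
  by (rule eq_matI)
    (auto simp: less_2_cases_iff quat_mat_index one_quat_def complex_eq_iff)

lemma trace_quat_mat_one: "mat_trace (quat_mat 1) = 2"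
  by (simp add: quat_mat_one mat_trace_def)

lemma quat_mat_mult_vec:
  "quat_mat x *\<^sub>v vec_of_list [a, b] = vec_of_list
    [Complex (re x) (im1 x) * a + Complex (im2 x) (im3 x) * b,
     Complex (- im2 x) (im3 x) * a + Complex (re x) (- im1 x) * b]"
  by (rule eq_vecI)
    (auto simp: quat_mat_index scalar_prod_def numeral_2_eq_2 less_Suc_eq
      vec_of_list_index)

text \<open>The unit \<open>i\<close> acts on the two coordinates by the distinct scalars \<open>\<i>\<close> and \<open>-\<i>\<close>, so an
  invariant subspace contains the components of its vectors. The unit \<open>j\<close>, acting by
  \<open>(a, b) \<mapsto> (b, -a)\<close>, carries one coordinate line to the other. Hence a nonzero
  invariant subspace contains both lines.\<close>

lemma Q8_invariant_subspace:
  assumes W: "VectorSpace.subspace class_ring W (module_vec TYPE(complex) 2)"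
    and inv: "\<And>h w. h \<in> Q8 \<Longrightarrow> w \<in> W \<Longrightarrow> quat_mat h *\<^sub>v w \<in> W"
  shows "W = {0\<^sub>v 2} \<or> W = carrier_vec 2"
proof -
  interpret submodule class_ring W "module_vec TYPE(complex) 2"
    using W by (simp add: subspace_def)
  let ?v = "\<lambda>a b :: complex. vec_of_list [a, b]"
  have sub: "W \<subseteq> carrier_vec 2" and zero: "0\<^sub>v 2 \<in> W"
    using subset zero_closed by (simp_all add: module_vec_simps)
  have vec_eq: "w = ?v (w $ 0) (w $ 1)" if "w \<in> carrier_vec 2" for w
    using that by (intro eq_vecI) (auto simp: less_Suc_eq numeral_2_eq_2 vec_of_list_index)
  have add: "?v (a + c) (b + d) \<in> W" if "?v a b \<in> W" "?v c d \<in> W" for a b c d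
  proof -
    have "?v a b + ?v c d = ?v (a + c) (b + d)"
      by (rule eq_vecI) (auto simp: less_Suc_eq vec_of_list_index)
    with m_closed[OF that] show ?thesis by (simp add: module_vec_simps)
  qed
  have scale: "?v (c * a) (c * b) \<in> W" if "?v a b \<in> W" for a b c
  proof -
    have "c \<cdot>\<^sub>v ?v a b = ?v (c * a) (c * b)"
      by (rule eq_vecI) (auto simp: less_Suc_eq vec_of_list_index)
    with smult_closed[OF _ that, of c] show ?thesis
      by (simp add: module_vec_simps class_ring_simps)
  qed
  have act_i: "?v (\<i> * a) (- \<i> * b) \<in> W" if "?v a b \<in> W" for a b
    using inv[OF _ that, of "Quat 0 1 0 0"]
    unfolding quat_mat_mult_vec by (simp add: Q8_def qnorm_def Complex_eq)
  have act_j: "?v b (- a) \<in> W" if "?v a b \<in> W" for a b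
    using inv[OF _ that, of "Quat 0 0 1 0"]
    unfolding quat_mat_mult_vec by (simp add: Q8_def qnorm_def Complex_eq)
  \<comment> \<open>The projection to the first eigenline of \<open>i\<close> is \<open>(1 - \<i> \<cdot> i) / 2\<close>.\<close>
  have fst_coord: "?v a 0 \<in> W" if "?v a b \<in> W" for a b
    using scale[OF add[OF that scale[OF act_i[OF that], of "- \<i>"]], of "1/2"] by simp
  have full: "W = carrier_vec 2" if "?v a 0 \<in> W" "a \<noteq> 0" for a
  proof
    show "carrier_vec 2 \<subseteq> W"
    proof
      fix w :: "complex vec" assume w: "w \<in> carrier_vec 2"
      have "?v (w $ 0) (w $ 1) \<in> W"
        using add[OF scale[OF that(1), of "w $ 0 / a"] scale[OF act_j[OF that(1)], of "- w $ 1 / a"]]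
          that(2) by simp
      with vec_eq[OF w] show "w \<in> W" by simp
    qed
  qed (rule sub)
  show ?thesis
  proof (cases "W = {0\<^sub>v 2}")
    case False
    with zero obtain w where w: "w \<in> W" "w \<noteq> 0\<^sub>v 2" by blast
    then obtain a b where ab: "w = ?v a b"
      using vec_eq sub by blast
    have "a \<noteq> 0 \<or> b \<noteq> 0"
      using w(2) unfolding ab by (auto simp: vec_eq_iff less_2_cases_iff vec_of_list_index)
    then show ?thesis
      using full fst_coord act_j w(1) unfolding ab by blast
  qed blast
qed

lemma irreducible_affine_rep:
  "irreducible_representation (affine_group p) 2 (\<lambda>g. quat_mat (snd g))"
  unfolding irreducible_representation_def
proof (intro conjI allI impI)
  have "quat_mat h \<in> Units (ring_mat TYPE(complex) 2 ())" if "h \<in> Q8" for h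
  proof -
    have "quat_mat (qcnj h) * quat_mat h = 1\<^sub>m 2" "quat_mat h * quat_mat (qcnj h) = 1\<^sub>m 2"
      using that by (simp_all add: Q8_qcnj_mult quat_mat_one flip: quat_mat_mult)
    then show ?thesis
      unfolding Units_def ring_mat_simps using quat_mat_carrier by blast
  qed
  then show "complex_representation (affine_group p) 2 (\<lambda>g. quat_mat (snd g))"
    by (auto simp: complex_representation_def hom_def GL_mat_def units_of_carrier units_of_mult
        affine_group_simps ring_mat_simps quat_mat_mult)
next
  fix W
  assume W: "VectorSpace.subspace class_ring W (module_vec TYPE(complex) 2)"
    and inv: "\<forall>g\<in>carrier (affine_group p). \<forall>w\<in>W. quat_mat (snd g) *\<^sub>v w \<in> W"
  show "W = {0\<^sub>v 2} \<or> W = carrier_vec 2"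
    using W
  proof (rule Q8_invariant_subspace)
    fix h w assume "h \<in> Q8" "w \<in> W"
    moreover from this have "(qmod p 0, h) \<in> carrier (affine_group p)"
      by (simp add: affine_group_simps)
    ultimately show "quat_mat h *\<^sub>v w \<in> W"
      using inv by fastforce
  qed
qed simp

section \<open>Transport along isomorphisms\<close>

text \<open>Surjectivity is what preserves irreducibility: both groups have the same operators in their
  image, hence the same invariant subspaces.\<close>

lemma irreducible_representation_comp_iso:
  assumes \<rho>: "irreducible_representation H n \<rho>" and \<phi>: "\<phi> \<in> iso G H"
  shows "irreducible_representation G n (\<rho> \<circ> \<phi>)"
proof -
  have surj: "\<phi> ` carrier G = carrier H" and hom: "\<phi> \<in> hom G H"
    using \<phi> by (auto simp: iso_def bij_betw_def)
  have "\<rho> \<circ> \<phi> \<in> hom G (GL_mat n)"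
    using \<rho> hom_compose[OF hom]
    unfolding irreducible_representation_def complex_representation_def by blast
  with \<rho> show ?thesis
    unfolding irreducible_representation_def complex_representation_def surj[symmetric] by simp
qed

lemma p_singular_iso:
  assumes "group G" "group H" and \<phi>: "\<phi> \<in> iso G H" and g: "p_singular G p g"
  shows "p_singular H p (\<phi> g)"
proof -
  interpret G: group G by fact
  interpret H: group H by fact
  have hom: "\<phi> \<in> hom G H" and inj: "inj_on \<phi> (carrier G)"
    using \<phi> by (auto simp: iso_def bij_betw_def)
  interpret group_hom G H \<phi>
    using hom by unfold_locales
  have mem: "g \<in> carrier G"
    using g by (simp add: p_singular_def)
  have "\<phi> (g [^]\<^bsub>G\<^esub> H.ord (\<phi> g)) = \<phi> \<one>\<^bsub>G\<^esub>"
    using mem by (simp add: hom_nat_pow)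
  then have "g [^]\<^bsub>G\<^esub> H.ord (\<phi> g) = \<one>\<^bsub>G\<^esub>"
    using inj_onD[OF inj] mem by blast
  then have "G.ord g dvd H.ord (\<phi> g)"
    using G.pow_eq_id mem by blast
  with g mem show ?thesis
    unfolding p_singular_def by (auto intro: dvd_trans)
qed

text \<open>A finite group can be given any infinite type as its ambient type by numbering its
  elements; this makes a group of pairs of quaternions a group of natural numbers.\<close>

lemma finite_group_iso_nat:
  fixes G :: "('a, 'b) monoid_scheme"
  assumes "group G" "finite (carrier G)"
  obtains H :: "nat monoid" and \<phi> where "group H" "\<phi> \<in> iso H G"
proof -
  obtain f :: "'a \<Rightarrow> nat" where f: "inj_on f (carrier G)"
    using finite_imp_inj_to_nat_seg[OF assms(2)] by blast
  have H: "group (image_group f G)" "f \<in> iso G (image_group f G)"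
    using assms(1) f by (simp_all add: group.inj_imp_image_group_is_group inj_imp_image_group_iso)
  then show thesis
    using that group.iso_set_sym[OF assms(1) H(2)] by blast
qed

section \<open>A character with value two on the singular elements\<close>

theorem lemma4p2:
  fixes p :: nat
  assumes "Factorial_Ring.prime p" and "odd p"
  shows "\<exists>(G :: nat monoid) \<chi>. group G \<and> finite (carrier G) \<and> p dvd Coset.order G \<and>
           irreducible_character G \<chi> \<and> p_constant_with G p \<chi> 2"
proof -
  have p: "p > 0"
    using assms(1) by (rule prime_gt_0_nat)
  obtain G :: "nat monoid" and \<phi> where G: "group G" and \<phi>: "\<phi> \<in> iso G (affine_group p)"
    using finite_group_iso_nat[OF group_affine_group finite_affine_group[OF p]] by blast
  let ?\<chi> = "\<lambda>g. mat_trace (quat_mat (snd (\<phi> g)))"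
  have bij: "bij_betw \<phi> (carrier G) (carrier (affine_group p))"
    using \<phi> by (simp add: iso_def)
  have "finite (carrier G)"
    using bij_betw_finite[OF bij] finite_affine_group[OF p] by blast
  moreover have "p dvd Coset.order G"
    using order_affine_group[OF p] bij_betw_same_card[OF bij] by (simp add: Coset.order_def)
  moreover have "irreducible_character G ?\<chi>"
    unfolding irreducible_character_def
    using irreducible_representation_comp_iso[OF irreducible_affine_rep \<phi>] by fastforce
  moreover have "p_constant_with G p ?\<chi> 2"
    unfolding p_constant_with_def
  proof (intro allI impI)
    fix g assume "p_singular G p g"
    then have "p_singular (affine_group p) p (\<phi> g)"
      using p_singular_iso[OF G group_affine_group \<phi>] by blast
    then have "snd (\<phi> g) = 1"
      using p_singular_affine_group[OF assms, of "fst (\<phi> g)" "snd (\<phi> g)"] by simp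
    then show "?\<chi> g = 2"
      by (simp add: trace_quat_mat_one)
  qed
  ultimately show ?thesis
    using G by blast
qed

end
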